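(* Let $n\ge 5$ and let $K/k$ be a Galois extension of fields with Galois group isomorphic to the symmetric group $S_n$ or the alternating group $A_n$. Then $K/k$ has no Hopf Galois structure of cyclic type.
   Context: **Hopf Galois structures.** A Hopf Galois structure on a finite field extension $K/k$ is a pair $(\mathcal H,\mu)$, where $\mathcal H$ is a finite (finite-dimensional) cocommutative $k$-Hopf algebra and $\mu:\mathcal H\to \mathrm{End}_k(K)$ is a $k$-linear map that makes $K$ a left $\mathcal H$-module algebra and such that the induced map $K\otimes_k\mathcal H\to \mathrm{End}_k(K)$ is bijective. **Type.** If $K/k$ is Galois with group $G$, let $\lambda:G\to\mathrm{Sym}(G)$ be the left translation action. By the theorem of Greither and Pareigis, Hopf Galois structures on $K/k$ (up to isomorphism) are in bijection with regular subgroups $N$ of $\mathrm{Sym}(G)$ normalized by $\lambda(G)$; the Hopf algebra corresponding to $N$ is $K[N]^G$, where $G$ acts on $K$ by $k$-automorphisms and on $N$ by conjugation via $\lambda$. The type of the Hopf Galois structure is the isomorphism class of $N$; it is of cyclic type if $N$ is a cyclic group (necessarily of order $|G|$). *)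

theory Defs
  imports
    "HOL-Algebra.Module"
    "HOL-Algebra.Bij"
    "HOL-Algebra.Embedded_Algebras"
    "HOL-Algebra.Group_Action"
    "HOL-Algebra.Elementary_Groups"
    "HOL-Algebra.Sym_Groups"
begin

section \<open>Modules, algebras and linear maps\<close>

definition linear_map ::
    "('r, 'x) ring_scheme \<Rightarrow> ('r, 'm, 'y) module_scheme \<Rightarrow> ('r, 'p, 'z) module_scheme \<Rightarrow> ('m \<Rightarrow> 'p) \<Rightarrow> bool"
  where "linear_map R M P f \<longleftrightarrow>
    f \<in> carrier M \<rightarrow> carrier P \<and>
    (\<forall>x\<in>carrier M. \<forall>y\<in>carrier M. f (x \<oplus>\<^bsub>M\<^esub> y) = f x \<oplus>\<^bsub>P\<^esub> f y) \<and>
    (\<forall>a\<in>carrier R. \<forall>x\<in>carrier M. f (a \<odot>\<^bsub>M\<^esub> x) = a \<odot>\<^bsub>P\<^esub> f x)"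

text \<open>Associative unital algebras. The locale \<^locale>\<open>algebra\<close> is not used, since it covers only
  commutative algebras.\<close>

locale assoc_algebra = module R A + A: ring A for R (structure) and A (structure) +
  assumes smult_mult_left:
      "\<lbrakk>a \<in> carrier R; x \<in> carrier A; y \<in> carrier A\<rbrakk> \<Longrightarrow>
        (a \<odot>\<^bsub>A\<^esub> x) \<otimes>\<^bsub>A\<^esub> y = a \<odot>\<^bsub>A\<^esub> (x \<otimes>\<^bsub>A\<^esub> y)"
    and smult_mult_right:
      "\<lbrakk>a \<in> carrier R; x \<in> carrier A; y \<in> carrier A\<rbrakk> \<Longrightarrow>
        x \<otimes>\<^bsub>A\<^esub> (a \<odot>\<^bsub>A\<^esub> y) = a \<odot>\<^bsub>A\<^esub> (x \<otimes>\<^bsub>A\<^esub> y)"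

text \<open>Scalars act by multiplication. With scalars from a subfield \<open>k\<close> of \<open>K\<close>, the record
  \<open>regular_algebra K\<close> is \<open>K\<close> regarded as a \<open>k\<close>-algebra.\<close>

definition regular_algebra :: "('r, 'x) ring_scheme \<Rightarrow> ('r, 'r) module"
  where "regular_algebra K =
    \<lparr>carrier = carrier K, monoid.mult = monoid.mult K, one = one K, zero = zero K, add = add K,
     smult = monoid.mult K\<rparr>"

definition End_algebra :: "('r, 'x) ring_scheme \<Rightarrow> ('r, 'm, 'y) module_scheme \<Rightarrow> ('r, 'm \<Rightarrow> 'm) module"
  where "End_algebra R M =
    \<lparr>carrier = {f \<in> extensional (carrier M). linear_map R M M f},
     monoid.mult = (\<lambda>f g. compose (carrier M) f g),
     one = (\<lambda>x\<in>carrier M. x),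
     zero = (\<lambda>x\<in>carrier M. \<zero>\<^bsub>M\<^esub>),
     add = (\<lambda>f g. \<lambda>x\<in>carrier M. f x \<oplus>\<^bsub>M\<^esub> g x),
     smult = (\<lambda>a f. \<lambda>x\<in>carrier M. a \<odot>\<^bsub>M\<^esub> f x)\<rparr>"

definition finitely_generated_module :: "('r, 'x) ring_scheme \<Rightarrow> ('r, 'm, 'y) module_scheme \<Rightarrow> bool"
  where "finitely_generated_module R M \<longleftrightarrow>
    (\<exists>B. finite B \<and> B \<subseteq> carrier M \<and>
      (\<forall>x\<in>carrier M. \<exists>c\<in>B \<rightarrow> carrier R. x = (\<Oplus>\<^bsub>M\<^esub>b\<in>B. c b \<odot>\<^bsub>M\<^esub> b)))"

text \<open>The free module on \<open>S\<close>: finitely supported functions. Multiplication and unit are left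
  unspecified.\<close>

definition free_module :: "('r, 'x) ring_scheme \<Rightarrow> 's set \<Rightarrow> ('r, 's \<Rightarrow> 'r) module"
  where "free_module R S =
    \<lparr>carrier = {f. (\<forall>s. f s \<in> carrier R) \<and> (\<forall>s. s \<notin> S \<longrightarrow> f s = \<zero>\<^bsub>R\<^esub>) \<and> finite {s. f s \<noteq> \<zero>\<^bsub>R\<^esub>}},
     monoid.mult = undefined,
     one = undefined,
     zero = (\<lambda>s. \<zero>\<^bsub>R\<^esub>),
     add = (\<lambda>f g s. f s \<oplus>\<^bsub>R\<^esub> g s),
     smult = (\<lambda>a f s. a \<otimes>\<^bsub>R\<^esub> f s)\<rparr>"

definition single :: "('r, 'x) ring_scheme \<Rightarrow> 's \<Rightarrow> 's \<Rightarrow> 'r"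
  where "single R s = (\<lambda>t. if t = s then \<one>\<^bsub>R\<^esub> else \<zero>\<^bsub>R\<^esub>)"


section \<open>Tensor products\<close>

definition tensor_relators ::
    "('r, 'x) ring_scheme \<Rightarrow> ('r, 'm, 'y) module_scheme \<Rightarrow> ('r, 'n, 'z) module_scheme \<Rightarrow> ('m \<times> 'n \<Rightarrow> 'r) set"
  where "tensor_relators R M N =
    (let F = free_module R (carrier M \<times> carrier N) in
      {single R (x \<oplus>\<^bsub>M\<^esub> x', y) \<ominus>\<^bsub>F\<^esub> (single R (x, y) \<oplus>\<^bsub>F\<^esub> single R (x', y)) | x x' y.
         x \<in> carrier M \<and> x' \<in> carrier M \<and> y \<in> carrier N} \<union>
      {single R (x, y \<oplus>\<^bsub>N\<^esub> y') \<ominus>\<^bsub>F\<^esub> (single R (x, y) \<oplus>\<^bsub>F\<^esub> single R (x, y')) | x y y'.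
         x \<in> carrier M \<and> y \<in> carrier N \<and> y' \<in> carrier N} \<union>
      {single R (a \<odot>\<^bsub>M\<^esub> x, y) \<ominus>\<^bsub>F\<^esub> (a \<odot>\<^bsub>F\<^esub> single R (x, y)) | a x y.
         a \<in> carrier R \<and> x \<in> carrier M \<and> y \<in> carrier N} \<union>
      {single R (x, a \<odot>\<^bsub>N\<^esub> y) \<ominus>\<^bsub>F\<^esub> (a \<odot>\<^bsub>F\<^esub> single R (x, y)) | a x y.
         a \<in> carrier R \<and> x \<in> carrier M \<and> y \<in> carrier N})"

definition tensor_kernel ::
    "('r, 'x) ring_scheme \<Rightarrow> ('r, 'm, 'y) module_scheme \<Rightarrow> ('r, 'n, 'z) module_scheme \<Rightarrow> ('m \<times> 'n \<Rightarrow> 'r) set"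
  where "tensor_kernel R M N =
    \<Inter> {U. submodule U R (free_module R (carrier M \<times> carrier N)) \<and> tensor_relators R M N \<subseteq> U}"

definition pure_tensor ::
    "('r, 'x) ring_scheme \<Rightarrow> ('r, 'm, 'y) module_scheme \<Rightarrow> ('r, 'n, 'z) module_scheme \<Rightarrow>
      'm \<Rightarrow> 'n \<Rightarrow> ('m \<times> 'n \<Rightarrow> 'r) set"
  where "pure_tensor R M N x y =
    tensor_kernel R M N +>\<^bsub>free_module R (carrier M \<times> carrier N)\<^esub> single R (x, y)"

definition tensor_module ::
    "('r, 'x) ring_scheme \<Rightarrow> ('r, 'm, 'y) module_scheme \<Rightarrow> ('r, 'n, 'z) module_scheme \<Rightarrow>
      ('r, ('m \<times> 'n \<Rightarrow> 'r) set) module"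
  where "tensor_module R M N =
    (let F = free_module R (carrier M \<times> carrier N); U = tensor_kernel R M N in
      \<lparr>carrier = a_rcosets\<^bsub>F\<^esub> U,
       monoid.mult = undefined,
       one = undefined,
       zero = U,
       add = (\<lambda>t u. t <+>\<^bsub>F\<^esub> u),
       smult = (\<lambda>a t. \<Union>f\<in>t. U +>\<^bsub>F\<^esub> (a \<odot>\<^bsub>F\<^esub> f))\<rparr>)"

text \<open>For a bilinear map \<open>b\<close> into \<open>P\<close>, \<open>tensor_lift R P b\<close> is the linear map out of the tensor product
  with \<open>x \<otimes> y \<mapsto> b x y\<close>; its value does not depend on the representative chosen.\<close>

definition tensor_lift ::
    "('r, 'x) ring_scheme \<Rightarrow> ('r, 'p, 'y) module_scheme \<Rightarrow> ('m \<Rightarrow> 'n \<Rightarrow> 'p) \<Rightarrow> ('m \<times> 'n \<Rightarrow> 'r) set \<Rightarrow> 'p"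
  where "tensor_lift R P b t =
    (let f = (SOME f. f \<in> t) in \<Oplus>\<^bsub>P\<^esub>p\<in>{p. f p \<noteq> \<zero>\<^bsub>R\<^esub>}. f p \<odot>\<^bsub>P\<^esub> b (fst p) (snd p))"

definition tensor ::
    "('r, 'x) ring_scheme \<Rightarrow> ('r, 'm, 'y) module_scheme \<Rightarrow> ('r, 'n, 'z) module_scheme \<Rightarrow>
      ('r, ('m \<times> 'n \<Rightarrow> 'r) set) module"
  where "tensor R A B =
    (tensor_module R A B)
      \<lparr>monoid.mult := (\<lambda>t u.
         tensor_lift R (tensor_module R A B)
           (\<lambda>a b. tensor_lift R (tensor_module R A B)
             (\<lambda>c d. pure_tensor R A B (a \<otimes>\<^bsub>A\<^esub> c) (b \<otimes>\<^bsub>B\<^esub> d)) u) t),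
       one := pure_tensor R A B \<one>\<^bsub>A\<^esub> \<one>\<^bsub>B\<^esub>\<rparr>"

text \<open>\<open>tensor_map R P Q f g\<close> is \<open>f \<otimes> g\<close>, where \<open>P\<close> and \<open>Q\<close> are the target modules.\<close>

definition tensor_map ::
    "('r, 'x) ring_scheme \<Rightarrow> ('r, 'p, 'y) module_scheme \<Rightarrow> ('r, 'q, 'z) module_scheme \<Rightarrow>
      ('m \<Rightarrow> 'p) \<Rightarrow> ('n \<Rightarrow> 'q) \<Rightarrow> ('m \<times> 'n \<Rightarrow> 'r) set \<Rightarrow> ('p \<times> 'q \<Rightarrow> 'r) set"
  where "tensor_map R P Q f g =
    tensor_lift R (tensor R P Q) (\<lambda>x y. pure_tensor R P Q (f x) (g y))"

definition tensor_assoc ::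
    "('r, 'x) ring_scheme \<Rightarrow> ('r, 'm, 'y) module_scheme \<Rightarrow>
      (('m \<times> 'm \<Rightarrow> 'r) set \<times> 'm \<Rightarrow> 'r) set \<Rightarrow> ('m \<times> ('m \<times> 'm \<Rightarrow> 'r) set \<Rightarrow> 'r) set"
  where "tensor_assoc R M =
    (let T = tensor R M M; P = tensor R M T in
      tensor_lift R P
        (\<lambda>t z. tensor_lift R P (\<lambda>x y. pure_tensor R M T x (pure_tensor R M M y z)) t))"


section \<open>Hopf algebras\<close>

record ('r, 'h) hopf = "('r, 'h) module" +
  comult :: "'h \<Rightarrow> ('h \<times> 'h \<Rightarrow> 'r) set"
  counit :: "'h \<Rightarrow> 'r"
  antipode :: "'h \<Rightarrow> 'h"

locale hopf_algebra = R: field R + H: assoc_algebra R H for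
    R :: "('r, 'x) ring_scheme" (structure) and H :: "('r, 'h, 'y) hopf_scheme" (structure) +
  assumes comult_linear: "linear_map R H (tensor R H H) (comult H)"
    and comult_hom: "comult H \<in> ring_hom H (tensor R H H)"
    and counit_linear: "linear_map R H (regular_algebra R) (counit H)"
    and counit_hom: "counit H \<in> ring_hom H R"
    and antipode_linear: "linear_map R H H (antipode H)"
    and coassoc:
      "h \<in> carrier H \<Longrightarrow>
        tensor_assoc R H (tensor_map R (tensor R H H) H (comult H) id (comult H h)) =
        tensor_map R H (tensor R H H) id (comult H) (comult H h)"
    and counit_left: "h \<in> carrier H \<Longrightarrow> tensor_lift R H (\<lambda>x y. counit H x \<odot>\<^bsub>H\<^esub> y) (comult H h) = h"
    and counit_right: "h \<in> carrier H \<Longrightarrow> tensor_lift R H (\<lambda>x y. counit H y \<odot>\<^bsub>H\<^esub> x) (comult H h) = h"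
    and antipode_left:
      "h \<in> carrier H \<Longrightarrow>
        tensor_lift R H (\<lambda>x y. antipode H x \<otimes>\<^bsub>H\<^esub> y) (comult H h) = counit H h \<odot>\<^bsub>H\<^esub> \<one>\<^bsub>H\<^esub>"
    and antipode_right:
      "h \<in> carrier H \<Longrightarrow>
        tensor_lift R H (\<lambda>x y. x \<otimes>\<^bsub>H\<^esub> antipode H y) (comult H h) = counit H h \<odot>\<^bsub>H\<^esub> \<one>\<^bsub>H\<^esub>"

definition cocommutative :: "('r, 'x) ring_scheme \<Rightarrow> ('r, 'h, 'y) hopf_scheme \<Rightarrow> bool"
  where "cocommutative R H \<longleftrightarrow>
    (\<forall>h\<in>carrier H.
      tensor_lift R (tensor R H H) (\<lambda>x y. pure_tensor R H H y x) (comult H h) = comult H h)"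

text \<open>The group algebra \<open>K[\<Gamma>]\<close>, an element being the function of its coefficients. The elements of
  \<open>\<Gamma>\<close> are grouplike.\<close>

definition group_algebra :: "('a, 'x) ring_scheme \<Rightarrow> ('g, 'y) monoid_scheme \<Rightarrow> ('a, 'g \<Rightarrow> 'a) module"
  where "group_algebra K \<Gamma> =
    (free_module K (carrier \<Gamma>))
      \<lparr>monoid.mult := (\<lambda>f g z.
         \<Oplus>\<^bsub>K\<^esub>p\<in>{(x, y). f x \<noteq> \<zero>\<^bsub>K\<^esub> \<and> g y \<noteq> \<zero>\<^bsub>K\<^esub> \<and> x \<otimes>\<^bsub>\<Gamma>\<^esub> y = z}.
           f (fst p) \<otimes>\<^bsub>K\<^esub> g (snd p)),
       one := single K \<one>\<^bsub>\<Gamma>\<^esub>\<rparr>"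

definition group_hopf_algebra :: "('a, 'x) ring_scheme \<Rightarrow> ('g, 'y) monoid_scheme \<Rightarrow> ('a, 'g \<Rightarrow> 'a) hopf"
  where "group_hopf_algebra K \<Gamma> =
    (let A = group_algebra K \<Gamma>; T = tensor K A A in
      \<lparr>carrier = carrier A, monoid.mult = monoid.mult A, one = one A, zero = zero A,
       add = add A, smult = smult A,
       comult = (\<lambda>f. \<Oplus>\<^bsub>T\<^esub>x\<in>{x. f x \<noteq> \<zero>\<^bsub>K\<^esub>}. f x \<odot>\<^bsub>T\<^esub> pure_tensor K A A (single K x) (single K x)),
       counit = (\<lambda>f. \<Oplus>\<^bsub>K\<^esub>x\<in>{x. f x \<noteq> \<zero>\<^bsub>K\<^esub>}. f x),
       antipode = (\<lambda>f x. if x \<in> carrier \<Gamma> then f (inv\<^bsub>\<Gamma>\<^esub> x) else \<zero>\<^bsub>K\<^esub>)\<rparr>)"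


section \<open>Galois extensions\<close>

text \<open>A subfield \<open>k\<close> of \<open>K\<close> is given by its carrier set; as a ring it is \<open>scalars K k\<close>.\<close>

abbreviation scalars :: "('a, 'x) ring_scheme \<Rightarrow> 'a set \<Rightarrow> ('a, 'x) ring_scheme"
  where "scalars K k \<equiv> K\<lparr>carrier := k\<rparr>"

definition galois_group :: "('a, 'x) ring_scheme \<Rightarrow> 'a set \<Rightarrow> ('a \<Rightarrow> 'a) monoid"
  where "galois_group K k =
    (BijGroup (carrier K))
      \<lparr>carrier := {\<sigma> \<in> Bij (carrier K). \<sigma> \<in> ring_hom K K \<and> (\<forall>a\<in>k. \<sigma> a = a)}\<rparr>"

definition finite_field_extension :: "('a, 'x) ring_scheme \<Rightarrow> 'a set \<Rightarrow> bool"
  where "finite_field_extension K k \<longleftrightarrow>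
    field K \<and> subfield k K \<and> ring.finite_dimension K k (carrier K)"

definition galois_extension :: "('a, 'x) ring_scheme \<Rightarrow> 'a set \<Rightarrow> bool"
  where "galois_extension K k \<longleftrightarrow>
    finite_field_extension K k \<and>
    {x \<in> carrier K. \<forall>\<sigma>\<in>carrier (galois_group K k). \<sigma> x = x} = k"


section \<open>Hopf Galois structures\<close>

text \<open>Together, linearity of \<open>\<mu>\<close> and \<open>\<mu> \<in> ring_hom H E\<close> make \<open>K\<close> a left \<open>H\<close>-module. The last condition is
  the bijectivity of \<open>K \<otimes>\<^sub>k H \<rightarrow> End\<^sub>k(K)\<close>, \<open>c \<otimes> h \<mapsto> (x \<mapsto> c \<cdot> \<mu>(h)(x))\<close>.\<close>

definition hopf_galois_structure ::
    "('a, 'x) ring_scheme \<Rightarrow> 'a set \<Rightarrow> ('a, 'h, 'y) hopf_scheme \<Rightarrow> ('h \<Rightarrow> 'a \<Rightarrow> 'a) \<Rightarrow> bool"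
  where "hopf_galois_structure K k H \<mu> \<longleftrightarrow>
    (let R = scalars K k; L = regular_algebra K; E = End_algebra R L in
      finite_field_extension K k \<and>
      hopf_algebra R H \<and> finitely_generated_module R H \<and> cocommutative R H \<and>
      linear_map R H E \<mu> \<and> \<mu> \<in> ring_hom H E \<and>
      (\<forall>h\<in>carrier H. \<forall>x\<in>carrier K. \<forall>y\<in>carrier K.
        \<mu> h (x \<otimes>\<^bsub>K\<^esub> y) = tensor_lift R L (\<lambda>a b. \<mu> a x \<otimes>\<^bsub>K\<^esub> \<mu> b y) (comult H h)) \<and>
      (\<forall>h\<in>carrier H. \<mu> h \<one>\<^bsub>K\<^esub> = counit H h) \<and>
      bij_betw (tensor_lift R E (\<lambda>c h. \<lambda>x\<in>carrier K. c \<otimes>\<^bsub>K\<^esub> \<mu> h x))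
        (carrier (tensor R L H)) (carrier E))"

definition hopf_galois_iso ::
    "('a, 'x) ring_scheme \<Rightarrow> 'a set \<Rightarrow> ('a, 'h, 'y) hopf_scheme \<Rightarrow> ('h \<Rightarrow> 'a \<Rightarrow> 'a) \<Rightarrow>
      ('a, 'h', 'z) hopf_scheme \<Rightarrow> ('h' \<Rightarrow> 'a \<Rightarrow> 'a) \<Rightarrow> ('h \<Rightarrow> 'h') \<Rightarrow> bool"
  where "hopf_galois_iso K k H \<mu> H' \<mu>' \<phi> \<longleftrightarrow>
    (let R = scalars K k in
      \<phi> \<in> ring_iso H H' \<and> linear_map R H H' \<phi> \<and>
      (\<forall>h\<in>carrier H.
        comult H' (\<phi> h) = tensor_map R H' H' \<phi> \<phi> (comult H h) \<and>
        counit H' (\<phi> h) = counit H h \<and>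
        antipode H' (\<phi> h) = \<phi> (antipode H h) \<and>
        (\<forall>x\<in>carrier K. \<mu>' (\<phi> h) x = \<mu> h x)))"


section \<open>The Greither--Pareigis correspondence\<close>

definition left_translation :: "('g, 'x) monoid_scheme \<Rightarrow> 'g \<Rightarrow> 'g \<Rightarrow> 'g"
  where "left_translation G g = (\<lambda>x\<in>carrier G. g \<otimes>\<^bsub>G\<^esub> x)"

definition regular_subgroup :: "('g \<Rightarrow> 'g) set \<Rightarrow> 'g set \<Rightarrow> bool"
  where "regular_subgroup N X \<longleftrightarrow>
    subgroup N (BijGroup X) \<and> (\<forall>x\<in>X. \<forall>y\<in>X. \<exists>!\<eta>. \<eta> \<in> N \<and> \<eta> x = y)"

definition regular_normalized_subgroup :: "('g, 'x) monoid_scheme \<Rightarrow> ('g \<Rightarrow> 'g) set \<Rightarrow> bool"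
  where "regular_normalized_subgroup G N \<longleftrightarrow>
    regular_subgroup N (carrier G) \<and>
    left_translation G ` carrier G \<subseteq> normalizer (BijGroup (carrier G)) N"

definition translation_conj :: "('g, 'x) monoid_scheme \<Rightarrow> 'g \<Rightarrow> ('g \<Rightarrow> 'g) \<Rightarrow> ('g \<Rightarrow> 'g)"
  where "translation_conj G g \<eta> =
    (let S = BijGroup (carrier G) in
      left_translation G g \<otimes>\<^bsub>S\<^esub> \<eta> \<otimes>\<^bsub>S\<^esub> inv\<^bsub>S\<^esub> left_translation G g)"

abbreviation perm_subgroup :: "('g, 'x) monoid_scheme \<Rightarrow> ('g \<Rightarrow> 'g) set \<Rightarrow> ('g \<Rightarrow> 'g) monoid"
  where "perm_subgroup G N \<equiv> (BijGroup (carrier G))\<lparr>carrier := N\<rparr>"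

text \<open>The \<open>k\<close>-algebra \<open>K[N]\<^sup>G\<close> for \<open>G = Gal(K/k)\<close>. The fixed-point condition says that
  \<open>\<Sum>\<eta>. f \<eta> \<cdot> \<eta>\<close> equals \<open>\<Sum>\<eta>. g (f \<eta>) \<cdot> (\<lambda>(g) \<eta> \<lambda>(g)\<^sup>-\<^sup>1)\<close>.\<close>

definition fixed_algebra ::
    "('a, 'x) ring_scheme \<Rightarrow> 'a set \<Rightarrow> (('a \<Rightarrow> 'a) \<Rightarrow> ('a \<Rightarrow> 'a)) set \<Rightarrow>
      ('a, (('a \<Rightarrow> 'a) \<Rightarrow> ('a \<Rightarrow> 'a)) \<Rightarrow> 'a) hopf"
  where "fixed_algebra K k N =
    (let G = galois_group K k; B = group_hopf_algebra K (perm_subgroup G N) in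
      B\<lparr>carrier := {f \<in> carrier B. \<forall>g\<in>carrier G. \<forall>\<eta>\<in>N. f (translation_conj G g \<eta>) = g (f \<eta>)}\<rparr>)"

text \<open>The Hopf algebra structure on \<open>A = K[N]\<^sup>G\<close> is the one inherited from \<open>B = K[N]\<close>. By Galois
  descent the canonical map from \<open>A \<otimes>\<^sub>k A\<close> to \<open>B \<otimes>\<^sub>K B\<close> is injective, and its image contains the
  comultiplication in \<open>B\<close> of every element of \<open>A\<close>; this determines the comultiplication of \<open>A\<close>.\<close>

definition greither_pareigis_hopf ::
    "('a, 'x) ring_scheme \<Rightarrow> 'a set \<Rightarrow> (('a \<Rightarrow> 'a) \<Rightarrow> ('a \<Rightarrow> 'a)) set \<Rightarrow>
      ('a, (('a \<Rightarrow> 'a) \<Rightarrow> ('a \<Rightarrow> 'a)) \<Rightarrow> 'a) hopf"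
  where "greither_pareigis_hopf K k N =
    (let B = group_hopf_algebra K (perm_subgroup (galois_group K k) N);
         A = fixed_algebra K k N; R = scalars K k in
      A\<lparr>comult := (\<lambda>f. THE t. t \<in> carrier (tensor R A A) \<and>
          tensor_lift R (tensor K B B) (pure_tensor K B B) t = comult B f)\<rparr>)"

text \<open>\<open>(\<Sum>\<eta>. f \<eta> \<cdot> \<eta>) \<cdot> x = \<Sum>\<eta>. f \<eta> \<cdot> (\<eta>\<^sup>-\<^sup>1(1\<^sub>G))(x)\<close>, where \<open>\<eta>\<^sup>-\<^sup>1(1\<^sub>G)\<close> is an element of the Galois group.\<close>

definition greither_pareigis_action ::
    "('a, 'x) ring_scheme \<Rightarrow> 'a set \<Rightarrow> (('a \<Rightarrow> 'a) \<Rightarrow> ('a \<Rightarrow> 'a)) set \<Rightarrow>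
      ((('a \<Rightarrow> 'a) \<Rightarrow> ('a \<Rightarrow> 'a)) \<Rightarrow> 'a) \<Rightarrow> 'a \<Rightarrow> 'a"
  where "greither_pareigis_action K k N f =
    (let G = galois_group K k; S = BijGroup (carrier G) in
      (\<lambda>x\<in>carrier K. \<Oplus>\<^bsub>K\<^esub>\<eta>\<in>N. f \<eta> \<otimes>\<^bsub>K\<^esub> ((inv\<^bsub>S\<^esub> \<eta>) \<one>\<^bsub>G\<^esub>) x))"

definition corresponds_to_subgroup ::
    "('a, 'x) ring_scheme \<Rightarrow> 'a set \<Rightarrow> ('a, 'h, 'y) hopf_scheme \<Rightarrow> ('h \<Rightarrow> 'a \<Rightarrow> 'a) \<Rightarrow>
      (('a \<Rightarrow> 'a) \<Rightarrow> ('a \<Rightarrow> 'a)) set \<Rightarrow> bool"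
  where "corresponds_to_subgroup K k H \<mu> N \<longleftrightarrow>
    regular_normalized_subgroup (galois_group K k) N \<and>
    (\<exists>\<phi>. hopf_galois_iso K k H \<mu>
      (greither_pareigis_hopf K k N) (greither_pareigis_action K k N) \<phi>)"

definition cyclic_type ::
    "('a, 'x) ring_scheme \<Rightarrow> 'a set \<Rightarrow> ('a, 'h, 'y) hopf_scheme \<Rightarrow> ('h \<Rightarrow> 'a \<Rightarrow> 'a) \<Rightarrow> bool"
  where "cyclic_type K k H \<mu> \<longleftrightarrow>
    (\<exists>N. corresponds_to_subgroup K k H \<mu> N \<and> cyclic_group (perm_subgroup (galois_group K k) N))"

end

theory Submission
  imports Defs
begin

text \<open>
  By the definition of the type, a Hopf Galois structure of cyclic type yields a regular cyclic
  subgroup \<open>N\<close> of \<open>Sym(G)\<close> normalized by \<open>\<lambda>(G)\<close>. Conjugation maps \<open>\<lambda>(G)\<close> into \<open>Aut(N)\<close>, which is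
  abelian since \<open>N\<close> is cyclic; so commutators of \<open>\<lambda>(G)\<close> centralize \<open>N\<close>. A regular abelian group is its
  own centralizer in \<open>Sym(G)\<close>, hence the derived subgroup of \<open>\<lambda>(G)\<close> lies in \<open>N\<close> and is abelian. Thus
  \<open>G\<close> is solvable, unlike \<open>S\<^sub>n\<close> and \<open>A\<^sub>n\<close> for \<open>n \<ge> 5\<close>.
\<close>

lemma (in group) conj_hom:
  assumes "g \<in> carrier G"
  shows "group_hom G G (\<lambda>z. g \<otimes> z \<otimes> inv g)"
  using assms
  by (intro group_hom.intro group_hom_axioms.intro is_group homI) (simp_all add: m_assoc inv_solve_left)

lemma (in group) conj_mult:
  assumes "g \<in> carrier G" "h \<in> carrier G" "z \<in> carrier G"
  shows "(g \<otimes> h) \<otimes> z \<otimes> inv (g \<otimes> h) = g \<otimes> (h \<otimes> z \<otimes> inv h) \<otimes> inv g"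
  using assms by (simp add: inv_mult_group m_assoc)

text \<open>Conjugation by an element of \<open>L\<close> acts on \<open>N\<close> as an
  endomorphism, so it is determined by the exponent of the power to which it sends the generator
  \<open>x\<close>. Exponents multiply under composition, so two such conjugations commute on
  \<open>N\<close>, and a commutator acts trivially. Integer exponents also cover an infinite cyclic
  \<open>N\<close>.\<close>

lemma (in group) commutator_centralizes_cyclic:
  assumes x: "x \<in> carrier G" and N: "N = range (\<lambda>k::int. x [^] k)"
    and L: "subgroup L G" and normal: "\<And>g z. g \<in> L \<Longrightarrow> z \<in> N \<Longrightarrow> g \<otimes> z \<otimes> inv g \<in> N"
    and gh: "g \<in> L" "h \<in> L" and z: "z \<in> N"
  shows "(g \<otimes> h \<otimes> inv g \<otimes> inv h) \<otimes> z = z \<otimes> (g \<otimes> h \<otimes> inv g \<otimes> inv h)"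
proof -
  define \<kappa> where "\<kappa> g z = g \<otimes> z \<otimes> inv g" for g z
  interpret L: subgroup L G by (rule L)
  have [simp]: "g \<in> carrier G" "h \<in> carrier G"
    using gh by simp_all
  have NG: "y \<in> carrier G" if "y \<in> N" for y
    using that x N by auto
  have xN: "x \<in> N"
    using x unfolding N by (metis int_pow_1 rangeI)
  have pow: "\<kappa> u (x [^] k) = \<kappa> u x [^] k" if "u \<in> carrier G" for u and k :: int
    using group_hom.hom_int_pow[OF conj_hom[OF that] x, of k] by (simp add: \<kappa>_def)
  have mult: "\<kappa> (u \<otimes> v) y = \<kappa> u (\<kappa> v y)" if "u \<in> carrier G" "v \<in> carrier G" "y \<in> carrier G" for u v y
    using conj_mult[OF that] by (simp add: \<kappa>_def)
  have in_N: "\<kappa> u y \<in> N" if "u \<in> L" "y \<in> N" for u y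
    using normal[OF that] by (simp add: \<kappa>_def)
  obtain m where m: "\<kappa> g x = x [^] (m::int)"
    using in_N[OF gh(1) xN] unfolding N by auto
  obtain l where l: "\<kappa> h x = x [^] (l::int)"
    using in_N[OF gh(2) xN] unfolding N by auto
  \<comment> \<open>Both sides equal \<open>x [^] (m * l)\<close>.\<close>
  have "\<kappa> (g \<otimes> h) x = \<kappa> (h \<otimes> g) x"
    using x by (simp add: mult m l pow int_pow_pow mult.commute)
  \<comment> \<open>Every element of \<open>N\<close> is a power of \<open>x\<close>, and
    conjugation commutes with powers.\<close>
  then have swap: "\<kappa> (g \<otimes> h) y = \<kappa> (h \<otimes> g) y" if "y \<in> N" for y
    using that unfolding N by (auto simp: pow)
  define c where "c = g \<otimes> h \<otimes> inv g \<otimes> inv h"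
  have c: "c \<in> carrier G" by (simp add: c_def)
  \<comment> \<open>The commutator is split as
    \<open>(g \<otimes> h) \<otimes> (inv g \<otimes> inv h)\<close>: the right factor lies in
    \<open>L\<close> and keeps \<open>z\<close> inside \<open>N\<close>, where \<open>swap\<close>
    may exchange \<open>g\<close> and \<open>h\<close> in the left factor.\<close>
  have "\<kappa> c z = \<kappa> (g \<otimes> h) (\<kappa> (inv g \<otimes> inv h) z)"
    using NG[OF z] by (subst mult[symmetric]) (simp_all add: c_def m_assoc)
  also have "\<dots> = \<kappa> (h \<otimes> g) (\<kappa> (inv g \<otimes> inv h) z)"
    by (intro swap in_N z L.m_closed L.m_inv_closed gh)
  also have "\<dots> = \<kappa> (h \<otimes> g \<otimes> (inv g \<otimes> inv h)) z"
    using NG[OF z] by (subst mult) simp_all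
  also have "h \<otimes> g \<otimes> (inv g \<otimes> inv h) = \<one>"
    by (simp flip: inv_mult_group)
  also have "\<kappa> \<one> z = z"
    using NG[OF z] by (simp add: \<kappa>_def)
  finally have "c \<otimes> z \<otimes> inv c = z"
    by (simp add: \<kappa>_def)
  then have "c \<otimes> z = z \<otimes> c"
    using c NG[OF z] by (metis inv_solve_right m_closed)
  then show ?thesis
    by (simp add: c_def)
qed

lemma BijGroup_carrier: "carrier (BijGroup X) = Bij X"
  by (simp add: BijGroup_def)

lemma BijGroup_mult_apply:
  "f \<in> Bij X \<Longrightarrow> g \<in> Bij X \<Longrightarrow> x \<in> X \<Longrightarrow> (f \<otimes>\<^bsub>BijGroup X\<^esub> g) x = f (g x)"
  by (simp add: BijGroup_def compose_def)

lemma Bij_apply: "f \<in> Bij X \<Longrightarrow> x \<in> X \<Longrightarrow> f x \<in> X"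
  using Bij_imp_funcset by fastforce

text \<open>By transitivity some \<open>\<eta>\<close> in \<open>N\<close> agrees with
  \<open>c\<close> at one point \<open>x\<close>. Both maps commute with all of \<open>N\<close>,
  and \<open>N\<close> moves \<open>x\<close> to every other point, so they agree
  everywhere.\<close>

lemma regular_abelian_self_centralizing:
  assumes N: "regular_subgroup N X" and "X \<noteq> {}"
    and comm: "\<And>\<eta> \<zeta>. \<eta> \<in> N \<Longrightarrow> \<zeta> \<in> N \<Longrightarrow>
      \<eta> \<otimes>\<^bsub>BijGroup X\<^esub> \<zeta> = \<zeta> \<otimes>\<^bsub>BijGroup X\<^esub> \<eta>"
    and c: "c \<in> Bij X"
    and centralizes: "\<And>\<zeta>. \<zeta> \<in> N \<Longrightarrow> c \<otimes>\<^bsub>BijGroup X\<^esub> \<zeta> = \<zeta> \<otimes>\<^bsub>BijGroup X\<^esub> c"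
  shows "c \<in> N"
proof -
  have sub: "N \<subseteq> Bij X"
    using N subgroup.subset unfolding regular_subgroup_def BijGroup_carrier[symmetric] by blast
  have trans: "\<exists>\<eta>. \<eta> \<in> N \<and> \<eta> x = y" if "x \<in> X" "y \<in> X" for x y
    using N that unfolding regular_subgroup_def by (meson ex1_implies_ex)
  obtain x where x: "x \<in> X" using \<open>X \<noteq> {}\<close> by blast
  obtain \<eta> where \<eta>: "\<eta> \<in> N" "\<eta> x = c x"
    using trans[OF x Bij_apply[OF c x]] by blast
  have "c y = \<eta> y" if "y \<in> X" for y
  proof -
    obtain \<zeta> where \<zeta>: "\<zeta> \<in> N" "\<zeta> x = y"
      using trans[OF x \<open>y \<in> X\<close>] by blast
    have "c (\<zeta> x) = \<zeta> (c x)"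
      using centralizes[OF \<zeta>(1)] \<zeta>(1) sub c x by (metis BijGroup_mult_apply subsetD)
    also have "\<dots> = \<eta> (\<zeta> x)"
      using comm[OF \<eta>(1) \<zeta>(1)] \<eta> \<zeta>(1) sub x by (metis BijGroup_mult_apply subsetD)
    finally show ?thesis by (simp add: \<zeta>(2))
  qed
  \<comment> \<open>Elements of \<open>Bij X\<close> are extensional, so agreement on
    \<open>X\<close> is equality.\<close>
  then have "c = \<eta>"
    using c \<eta>(1) sub by (meson Bij_imp_extensional extensionalityI subsetD)
  with \<eta>(1) show ?thesis by simp
qed

text \<open>The normalizer is defined as the stabilizer of \<open>H\<close> under conjugation of
  subsets of the carrier; this extracts the elementwise form.\<close>

lemma normalizer_conj_mem:
  assumes "H \<subseteq> carrier G" "g \<in> normalizer G H" "h \<in> H"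
  shows "g \<otimes>\<^bsub>G\<^esub> h \<otimes>\<^bsub>G\<^esub> inv\<^bsub>G\<^esub> g \<in> H"
proof -
  have "g <#\<^bsub>G\<^esub> H #>\<^bsub>G\<^esub> (inv\<^bsub>G\<^esub> g) = H"
    using assms(1,2) by (simp add: normalizer_def stabilizer_def)
  moreover have "g \<otimes>\<^bsub>G\<^esub> h \<otimes>\<^bsub>G\<^esub> inv\<^bsub>G\<^esub> g \<in> g <#\<^bsub>G\<^esub> H #>\<^bsub>G\<^esub> (inv\<^bsub>G\<^esub> g)"
    using assms(3) by (auto simp: l_coset_def r_coset_def)
  ultimately show ?thesis by simp
qed

lemma (in group) left_translation_Bij:
  assumes "g \<in> carrier G" shows "left_translation G g \<in> Bij (carrier G)"
proof -
  have "bij_betw (\<lambda>x. g \<otimes> x) (carrier G) (carrier G)"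
    using assms by (intro bij_betwI[where g = "\<lambda>x. inv g \<otimes> x"]) (auto simp: m_assoc[symmetric])
  then show ?thesis
    by (simp add: Bij_def left_translation_def bij_betw_restrict_eq)
qed

lemma (in group) left_translation_hom:
  "group_hom G (BijGroup (carrier G)) (left_translation G)"
proof (intro group_hom.intro group_hom_axioms.intro is_group group_BijGroup homI)
  show "left_translation G g \<in> carrier (BijGroup (carrier G))" if "g \<in> carrier G" for g
    using that by (simp add: BijGroup_carrier left_translation_Bij)
  show "left_translation G (g \<otimes> h) =
      left_translation G g \<otimes>\<^bsub>BijGroup (carrier G)\<^esub> left_translation G h"
    if "g \<in> carrier G" "h \<in> carrier G" for g h
    using that
    by (simp add: BijGroup_def left_translation_Bij)
      (auto simp: left_translation_def compose_def m_assoc fun_eq_iff)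
qed

lemma (in group) inj_left_translation: "inj_on (left_translation G) (carrier G)"
proof (rule inj_onI)
  fix g h assume gh: "g \<in> carrier G" "h \<in> carrier G" "left_translation G g = left_translation G h"
  then have "left_translation G g \<one> = left_translation G h \<one>" by simp
  with gh(1,2) show "g = h" by (simp add: left_translation_def)
qed

text \<open>The group-theoretic core, free of field theory: the second derived subgroup of the image
  of left translation is trivial, and solvability pulls back to \<open>G\<close> because left
  translation is injective.\<close>

theorem (in group) solvable_if_cyclic_regular_normalized:
  assumes N: "regular_normalized_subgroup G N" and cyc: "cyclic_group (perm_subgroup G N)"
  shows "solvable G"
proof -
  let ?S = "BijGroup (carrier G)" and ?L = "left_translation G ` carrier G"
  interpret S: group ?S by (rule group_BijGroup)
  interpret lt: group_hom G ?S "left_translation G" by (rule left_translation_hom)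
  have reg: "regular_subgroup N (carrier G)"
    using N by (simp add: regular_normalized_subgroup_def)
  then have subN: "subgroup N ?S"
    by (simp add: regular_subgroup_def)
  interpret N: group "perm_subgroup G N"
    by (rule S.subgroup_imp_group[OF subN])
  interpret N: comm_group "perm_subgroup G N"
    by (rule N.cyclic_imp_abelian_group[OF cyc])
  obtain x where x: "x \<in> N" and "N = range (\<lambda>k::int. x [^]\<^bsub>perm_subgroup G N\<^esub> k)"
    using cyc unfolding N.cyclic_group by auto
  \<comment> \<open>Powers are moved to the ambient permutation group, where the conjugating
    translations live.\<close>
  then have gen: "N = range (\<lambda>k::int. x [^]\<^bsub>?S\<^esub> k)"
    by (simp add: S.int_pow_consistent[OF subN x])
  have xS: "x \<in> carrier ?S"
    using subgroup.mem_carrier[OF subN x] .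
  have subL: "subgroup ?L ?S"
    by (rule lt.img_is_subgroup)
  have conj: "g \<otimes>\<^bsub>?S\<^esub> z \<otimes>\<^bsub>?S\<^esub> inv\<^bsub>?S\<^esub> g \<in> N" if "g \<in> ?L" "z \<in> N" for g z
    using N that subgroup.subset[OF subN] unfolding regular_normalized_subgroup_def
    by (intro normalizer_conj_mem) auto
  \<comment> \<open>The derived subgroup is generated by commutators, so it suffices to place each
    of them in \<open>N\<close>.\<close>
  have "derived ?S ?L \<subseteq> N"
    unfolding derived_def
  proof (rule S.generate_subgroup_incl[OF _ subN], safe)
    fix g h assume gh: "g \<in> carrier G" "h \<in> carrier G"
    let ?g = "left_translation G g" and ?h = "left_translation G h"
    let ?c = "?g \<otimes>\<^bsub>?S\<^esub> ?h \<otimes>\<^bsub>?S\<^esub> inv\<^bsub>?S\<^esub> ?g \<otimes>\<^bsub>?S\<^esub> inv\<^bsub>?S\<^esub> ?h"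
    show "?c \<in> N"
    proof (rule regular_abelian_self_centralizing[OF reg])
      show "carrier G \<noteq> {}" by auto
      show "\<eta> \<otimes>\<^bsub>?S\<^esub> \<zeta> = \<zeta> \<otimes>\<^bsub>?S\<^esub> \<eta>" if "\<eta> \<in> N" "\<zeta> \<in> N" for \<eta> \<zeta>
        using N.m_comm[of \<eta> \<zeta>] that by simp
      show "?c \<in> Bij (carrier G)"
        using gh by (simp flip: BijGroup_carrier)
      show "?c \<otimes>\<^bsub>?S\<^esub> \<zeta> = \<zeta> \<otimes>\<^bsub>?S\<^esub> ?c" if "\<zeta> \<in> N" for \<zeta>
        using gh that by (intro S.commutator_centralizes_cyclic[OF xS gen subL conj]) auto
    qed
  qed
  then have "derived ?S (derived ?S ?L) \<subseteq> derived ?S N"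
    by (rule S.mono_derived)
  also have "\<dots> = {\<one>\<^bsub>?S\<^esub>}"
    using N.derived_eq_singleton[of N] S.derived_consistent[OF _ subN, of N] by simp
  finally have "derived ?S (derived ?S ?L) = {\<one>\<^bsub>?S\<^esub>}"
    \<comment> \<open>The exponent \<open>2\<close> counts derivation steps; the twice derived
      subgroup contains the identity, which gives the reverse inclusion.\<close>
    using subgroup.one_closed[OF S.exp_of_derived_is_subgroup[OF subL, of 2]]
    by (auto simp: numeral_2_eq_2)
  then have "solvable_seq ?S ?L"
    using S.trivial_derived_seq_imp_solvable[OF subL, of 2] by (simp add: numeral_2_eq_2)
  then show ?thesis
    unfolding solvable_def
    by (intro lt.solvable_img_imp_solvable subgroup_self inj_left_translation)
qed

lemma (in group) solvable_iso:
  assumes "G \<cong> H" "group H" "solvable G"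
  shows "solvable H"
proof -
  obtain h where "h \<in> iso G H" using assms(1) by (auto simp: is_iso_def)
  then have "group_hom G H h" "h ` carrier G = carrier H"
    using assms(2) by (auto simp: iso_def bij_betw_def group_hom_def group_hom_axioms_def)
  then show ?thesis
    using assms(3) by (rule group_hom.surj_hom_imp_solvable)
qed

text \<open>\<open>galois_group\<close> is only a record with a restricted carrier; it is a group
  because that carrier is a subgroup of the permutations of \<open>carrier K\<close>.\<close>

lemma group_galois_group:
  assumes "ring K" "k \<subseteq> carrier K"
  shows "group (galois_group K k)"
proof -
  interpret ring K by (rule assms(1))
  interpret S: group "BijGroup (carrier K)" by (rule group_BijGroup)
  let ?A = "{\<sigma> \<in> Bij (carrier K). \<sigma> \<in> ring_hom K K \<and> (\<forall>a\<in>k. \<sigma> a = a)}"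
  have inj: "inj_on \<sigma> (carrier K)" and surj: "\<sigma> ` carrier K = carrier K" if "\<sigma> \<in> Bij (carrier K)" for \<sigma>
    using that by (auto simp: Bij_def bij_betw_def)
  have "subgroup ?A (BijGroup (carrier K))"
  proof (rule S.subgroupI)
    show "?A \<subseteq> carrier (BijGroup (carrier K))"
      by (auto simp: BijGroup_carrier)
    have "(\<lambda>x\<in>carrier K. x) \<in> ?A"
      using assms(2) by (auto intro!: ring_hom_memI simp: id_Bij)
    then show "?A \<noteq> {}" by blast
  next
    fix \<sigma> assume \<sigma>: "\<sigma> \<in> ?A"
    let ?\<tau> = "inv_into (carrier K) \<sigma>"
    note hom = ring_hom_memE[of \<sigma> K K]
    have \<tau>: "?\<tau> y \<in> carrier K" if "y \<in> carrier K" for y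
      using that \<sigma> surj inv_into_into[of y \<sigma> "carrier K"] by auto
    \<comment> \<open>The inverse of a bijection that respects a binary operation respects it too;
      the same fact serves for addition.\<close>
    have mult: "?\<tau> (x \<otimes>\<^bsub>K\<^esub> y) = ?\<tau> x \<otimes>\<^bsub>K\<^esub> ?\<tau> y" if "x \<in> carrier K" "y \<in> carrier K" for x y
      using \<sigma> that hom(2) by (intro Bij_inv_into_lemma) auto
    have add: "?\<tau> (x \<oplus>\<^bsub>K\<^esub> y) = ?\<tau> x \<oplus>\<^bsub>K\<^esub> ?\<tau> y" if "x \<in> carrier K" "y \<in> carrier K" for x y
      using \<sigma> that hom(3) by (intro Bij_inv_into_lemma) auto
    \<comment> \<open>Stated for any fixed point of \<open>\<sigma>\<close>, so that it yields
      preservation of the unit as well as of \<open>k\<close>.\<close>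
    have fixes_k: "?\<tau> a = a" if "a \<in> carrier K" "\<sigma> a = a" for a
      using \<sigma> inj that by (intro inv_into_f_eq) auto
    show "inv\<^bsub>BijGroup (carrier K)\<^esub> \<sigma> \<in> ?A"
      using \<sigma> assms(2) hom(4) restrict_inv_into_Bij[of \<sigma> "carrier K"]
      by (auto intro!: ring_hom_memI simp: inv_BijGroup \<tau> mult add fixes_k subset_iff)
  next
    fix \<sigma> \<tau> assume \<sigma>: "\<sigma> \<in> ?A" and \<tau>: "\<tau> \<in> ?A"
    then have "compose (carrier K) \<sigma> \<tau> \<in> ring_hom K K"
      by (intro ring_hom_memI) (simp_all add: compose_def ring_hom_memE[of \<sigma> K K] ring_hom_memE[of \<tau> K K])
    with \<sigma> \<tau> assms(2) show "\<sigma> \<otimes>\<^bsub>BijGroup (carrier K)\<^esub> \<tau> \<in> ?A"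
      by (auto simp: BijGroup_def compose_Bij compose_eq subset_iff)
  qed
  then show ?thesis
    unfolding galois_group_def by (rule S.subgroup_imp_group)
qed

theorem proposition6:
  fixes K :: "('a, 'x) ring_scheme" and k :: "'a set" and n :: nat
  assumes "n \<ge> 5"
    and "galois_extension K k"
    and "galois_group K k \<cong> sym_group n \<or> galois_group K k \<cong> alt_group n"
  shows "\<not> (\<exists>(H :: ('a, 'h) hopf) \<mu>. hopf_galois_structure K k H \<mu> \<and> cyclic_type K k H \<mu>)"
proof
  assume "\<exists>(H :: ('a, 'h) hopf) \<mu>. hopf_galois_structure K k H \<mu> \<and> cyclic_type K k H \<mu>"
  then obtain N where N: "regular_normalized_subgroup (galois_group K k) N"
    "cyclic_group (perm_subgroup (galois_group K k) N)"
    unfolding cyclic_type_def corresponds_to_subgroup_def by blast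
  have K: "field K" "subfield k K"
    using assms(2) by (simp_all add: galois_extension_def finite_field_extension_def)
  interpret group "galois_group K k"
    using K by (intro group_galois_group field.is_ring subfieldE(3))
  have "solvable (galois_group K k)"
    using N by (rule solvable_if_cyclic_regular_normalized)
  then have "solvable (sym_group n) \<or> solvable (alt_group n)"
    using assms(3) solvable_iso sym_group_is_group alt_group_is_group by blast
  then show False
    using assms(1) sym_group_is_unsolvable alt_group_is_unsolvable by blast
qed

end
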